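(* Let $\mathfrak{d}$ be the $4$-dimensional complex diamond Lie algebra with basis $e_1,\dots,e_4$ and brackets $[e_1,e_2]=e_3$, $[e_1,e_3]=-e_2$, $[e_2,e_3]=e_4$ (extended skew-symmetrically, all others zero), and let $\mathfrak{L}_2$ be the $4$-dimensional Leibniz algebra with nonzero brackets $[e_1,e_2]=e_3=-[e_2,e_1]$, $[e_1,e_4]=e_1=-[e_4,e_1]$, $[e_4,e_2]=e_2=-[e_2,e_4]$, $[e_4,e_4]=e_3$. Then the Lie algebra $\mathfrak{d}\oplus\mathbb{C}$ has Leibniz deformations to $\mathfrak{sl}(2,\mathbb{C})\oplus\mathbb{C}^2$ and to $\mathfrak{L}_2\oplus\mathbb{C}$. Moreover, $\mathfrak{d}\oplus\mathbb{C}$ has one nontrivial metric infinitesimal deformation which cannot be extended to a real metric deformation.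
   Context: All algebras are over $\mathbb{C}$. A left (resp. right) Leibniz algebra is a vector space $\mathfrak{L}$ with a bilinear bracket satisfying $[x,[y,z]]=[[x,y],z]+[y,[x,z]]$ (resp. $[x,[y,z]]=[[x,y],z]-[[x,z],y]$); a Leibniz algebra is one or the other. Lie algebras are Leibniz algebras. A bilinear form $B$ on $\mathfrak{L}$ is invariant if $B([x,y],z)=B(x,[y,z])$ for all $x,y,z$. $\mathfrak{L}$ is metric if it has a non-degenerate symmetric invariant bilinear form. A (formal $1$-parameter, Leibniz) deformation of $(\mathfrak{L},\mu_0)$ is a Leibniz bracket $\mu_t=\mu_0+t\phi_1+t^2\phi_2+\cdots$ on $\mathfrak{L}\otimes\mathbb{C}[[t]]$, with $\phi_i$ bilinear maps $\mathfrak{L}\times\mathfrak{L}\to\mathfrak{L}$. It is infinitesimal if the Leibniz identity is only required up to order $1$ (modulo $t^2$); such a deformation $\mu_0+t\phi_1$ is a real deformation if the Leibniz identity holds to all orders. An infinitesimal deformation is metric if $\mu_0+t\phi_1$ carries a non-degenerate symmetric invariant bilinear form; it is nontrivial if $\phi_1$ is not a Leibniz coboundary, i.e. not of the form $(x,y)\mapsto[x,f(y)]+[f(x),y]-f([x,y])$ with $f$ linear. A real metric deformation is a deformation that is a metric Leibniz algebra for $t\ne0$. $\mathfrak{L}$ has a deformation to a Leibniz algebra $\mathfrak{N}$ if there is a deformation $\mu_t$, polynomial in $t$, with $(\mathfrak{L},\mu_t)\cong\mathfrak{N}$ for all nonzero $t$ near $0$. $\mathfrak{sl}(2,\mathbb{C})$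 has brackets $[e_1,e_2]=e_3$, $[e_2,e_3]=2e_2$, $[e_1,e_3]=-2e_1$, and $\mathbb{C}^k$ is the $k$-dimensional abelian algebra. *)

theory Defs
  imports
    "HOL-Analysis.Analysis"
    "HOL-Computational_Algebra.Computational_Algebra"
begin

section \<open>Leibniz algebras on free modules of finite rank\<close>

text \<open>
  An algebra is given by its bracket on \<open>'k ^ 'n\<close>. The coefficient ring \<open>'k\<close> is
  \<open>complex\<close> for the algebras themselves, \<open>complex fps\<close> (formal power series in \<open>t\<close>) for
  deformations, and \<open>complex fls\<close> (formal Laurent series in \<open>t\<close>) for the generic fibre
  of a deformation.
\<close>

type_synonym ('k, 'n) bracket = "'k ^ 'n \<Rightarrow> 'k ^ 'n \<Rightarrow> 'k ^ 'n"

definition bilinear_over ::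
    "('k::comm_ring_1 \<Rightarrow> 'v::ab_group_add \<Rightarrow> 'v) \<Rightarrow> ('k \<Rightarrow> 'w::ab_group_add \<Rightarrow> 'w) \<Rightarrow> ('v \<Rightarrow> 'v \<Rightarrow> 'w) \<Rightarrow> bool"
  where "bilinear_over s s' f \<longleftrightarrow>
    (\<forall>x. module_hom s s' (f x)) \<and> (\<forall>y. module_hom s s' (\<lambda>x. f x y))"

abbreviation bilinear_bracket :: "('k::comm_ring_1, 'n::finite) bracket \<Rightarrow> bool"
  where "bilinear_bracket \<equiv> bilinear_over (*s) (*s)"

abbreviation bilinear_form :: "('k::comm_ring_1 ^ 'n::finite \<Rightarrow> 'k ^ 'n \<Rightarrow> 'k) \<Rightarrow> bool"
  where "bilinear_form \<equiv> bilinear_over (*s) (*)"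

definition left_leibnizator ::
    "('k::comm_ring_1, 'n::finite) bracket \<Rightarrow> 'k ^ 'n \<Rightarrow> 'k ^ 'n \<Rightarrow> 'k ^ 'n \<Rightarrow> 'k ^ 'n"
  where "left_leibnizator \<mu> x y z = \<mu> x (\<mu> y z) - (\<mu> (\<mu> x y) z + \<mu> y (\<mu> x z))"

definition right_leibnizator ::
    "('k::comm_ring_1, 'n::finite) bracket \<Rightarrow> 'k ^ 'n \<Rightarrow> 'k ^ 'n \<Rightarrow> 'k ^ 'n \<Rightarrow> 'k ^ 'n"
  where "right_leibnizator \<mu> x y z = \<mu> x (\<mu> y z) - (\<mu> (\<mu> x y) z - \<mu> (\<mu> x z) y)"

definition leibniz_algebra :: "('k::comm_ring_1, 'n::finite) bracket \<Rightarrow> bool"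
  where "leibniz_algebra \<mu> \<longleftrightarrow> bilinear_bracket \<mu> \<and>
    ((\<forall>x y z. left_leibnizator \<mu> x y z = 0) \<or> (\<forall>x y z. right_leibnizator \<mu> x y z = 0))"

definition symmetric_form :: "('v \<Rightarrow> 'v \<Rightarrow> 'k) \<Rightarrow> bool"
  where "symmetric_form B \<longleftrightarrow> (\<forall>x y. B x y = B y x)"

definition invariant_form :: "('v \<Rightarrow> 'v \<Rightarrow> 'v) \<Rightarrow> ('v \<Rightarrow> 'v \<Rightarrow> 'k) \<Rightarrow> bool"
  where "invariant_form \<mu> B \<longleftrightarrow> (\<forall>x y z. B (\<mu> x y) z = B x (\<mu> y z))"

definition nondegenerate_form :: "('v::zero \<Rightarrow> 'v \<Rightarrow> 'k::zero) \<Rightarrow> bool"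
  where "nondegenerate_form B \<longleftrightarrow> (\<forall>x. (\<forall>y. B x y = 0) \<longrightarrow> x = 0)"

definition metric_leibniz_algebra :: "('k::field, 'n::finite) bracket \<Rightarrow> bool"
  where "metric_leibniz_algebra \<mu> \<longleftrightarrow> leibniz_algebra \<mu> \<and>
    (\<exists>B. bilinear_form B \<and> symmetric_form B \<and> nondegenerate_form B \<and> invariant_form \<mu> B)"

definition algebra_isomorphic ::
    "('k::field, 'n::finite) bracket \<Rightarrow> ('k, 'm::finite) bracket \<Rightarrow> bool"
  where "algebra_isomorphic \<mu> \<nu> \<longleftrightarrow>
    (\<exists>f. Vector_Spaces.linear (*s) (*s) f \<and> bij f \<and> (\<forall>x y. f (\<mu> x y) = \<nu> (f x) (f y)))"


section \<open>Deformations\<close>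

definition bracket_of :: "('n::finite \<Rightarrow> 'n \<Rightarrow> 'k::comm_ring_1 ^ 'n) \<Rightarrow> ('k, 'n) bracket"
  where "bracket_of c x y = (\<Sum>i\<in>UNIV. \<Sum>j\<in>UNIV. (x $ i * y $ j) *s c i j)"

text \<open>
  For a sequence \<open>\<phi>\<close> of bilinear brackets, the formal sum of the \<open>t ^ m * \<phi> m\<close> is extended
  bilinearly from the standard basis of \<open>complex ^ 'n\<close> to the power series, respectively the
  Laurent series.
\<close>

definition power_series_bracket ::
    "(nat \<Rightarrow> (complex, 'n::finite) bracket) \<Rightarrow> (complex fps, 'n) bracket"
  where "power_series_bracket \<phi> =
    bracket_of (\<lambda>i j. \<chi> k. Abs_fps (\<lambda>m. \<phi> m (axis i 1) (axis j 1) $ k))"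

definition generic_fibre ::
    "(nat \<Rightarrow> (complex, 'n::finite) bracket) \<Rightarrow> (complex fls, 'n) bracket"
  where "generic_fibre \<phi> =
    bracket_of (\<lambda>i j. \<chi> k. fps_to_fls (Abs_fps (\<lambda>m. \<phi> m (axis i 1) (axis j 1) $ k)))"

definition deformation ::
    "(complex, 'n::finite) bracket \<Rightarrow> (nat \<Rightarrow> (complex, 'n) bracket) \<Rightarrow> bool"
  where "deformation \<mu> \<phi> \<longleftrightarrow> \<phi> 0 = \<mu> \<and> (\<forall>m. bilinear_bracket (\<phi> m)) \<and>
    leibniz_algebra (power_series_bracket \<phi>)"

definition first_order ::
    "(complex, 'n::finite) bracket \<Rightarrow> (complex, 'n) bracket \<Rightarrow> nat \<Rightarrow> (complex, 'n) bracket"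
  where "first_order \<mu> \<psi> m = (if m = 0 then \<mu> else if m = 1 then \<psi> else (\<lambda>x y. 0))"

definition zero_mod_t2 :: "complex fps ^ 'n::finite \<Rightarrow> bool"
  where "zero_mod_t2 v \<longleftrightarrow> (\<forall>k. fps_X ^ 2 dvd v $ k)"

definition infinitesimal_deformation ::
    "(complex, 'n::finite) bracket \<Rightarrow> (complex, 'n) bracket \<Rightarrow> bool"
  where "infinitesimal_deformation \<mu> \<psi> \<longleftrightarrow> bilinear_bracket \<mu> \<and> bilinear_bracket \<psi> \<and>
    ((\<forall>x y z. zero_mod_t2 (left_leibnizator (power_series_bracket (first_order \<mu> \<psi>)) x y z)) \<or>
     (\<forall>x y z. zero_mod_t2 (right_leibnizator (power_series_bracket (first_order \<mu> \<psi>)) x y z)))"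

text \<open>
  The form lives over the power series and may therefore depend on \<open>t\<close>; it is invariant under
  \<open>\<mu> + t * \<psi>\<close> exactly, not only modulo \<open>t ^ 2\<close>. Non-degeneracy over the local ring of power
  series means that the Gram determinant is a unit, i.e. that the form induced at \<open>t = 0\<close> on
  \<open>complex ^ 'n\<close> is non-degenerate: the constant coefficient of \<open>B x y\<close> vanishes for all \<open>y\<close>
  only if the vector \<open>x\<close> vanishes at \<open>t = 0\<close>.
\<close>

definition metric_infinitesimal_deformation ::
    "(complex, 'n::finite) bracket \<Rightarrow> (complex, 'n) bracket \<Rightarrow> bool"
  where "metric_infinitesimal_deformation \<mu> \<psi> \<longleftrightarrow> infinitesimal_deformation \<mu> \<psi> \<and>
    (\<exists>B. bilinear_form B \<and> symmetric_form B \<and>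
       (\<forall>x. (\<forall>y. fps_nth (B x y) 0 = 0) \<longrightarrow> (\<forall>k. fps_nth (x $ k) 0 = 0)) \<and>
       invariant_form (power_series_bracket (first_order \<mu> \<psi>)) B)"

definition leibniz_coboundary ::
    "(complex, 'n::finite) bracket \<Rightarrow> (complex, 'n) bracket \<Rightarrow> bool"
  where "leibniz_coboundary \<mu> \<psi> \<longleftrightarrow>
    (\<exists>f. Vector_Spaces.linear (*s) (*s) f \<and> (\<forall>x y. \<psi> x y = \<mu> x (f y) + \<mu> (f x) y - f (\<mu> x y)))"

text \<open>
  A formal power series bracket cannot be evaluated at a number, so \<open>metric for t \<noteq> 0\<close> is read as
  \<open>metric after inverting t\<close>. For a convergent family, being metric for all small \<open>t \<noteq> 0\<close>
  implies this.
\<close>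

definition real_metric_deformation ::
    "(complex, 'n::finite) bracket \<Rightarrow> (nat \<Rightarrow> (complex, 'n) bracket) \<Rightarrow> bool"
  where "real_metric_deformation \<mu> \<phi> \<longleftrightarrow>
    deformation \<mu> \<phi> \<and> metric_leibniz_algebra (generic_fibre \<phi>)"

definition has_deformation_to ::
    "(complex, 'n::finite) bracket \<Rightarrow> (complex, 'm::finite) bracket \<Rightarrow> bool"
  where "has_deformation_to \<mu> \<nu> \<longleftrightarrow>
    (\<exists>\<phi> N. deformation \<mu> \<phi> \<and> (\<forall>m>N. \<phi> m = (\<lambda>x y. 0)) \<and>
       (\<forall>\<^sub>F t in at 0. algebra_isomorphic (\<lambda>x y. \<Sum>m\<le>N. t ^ m *s \<phi> m x y) \<nu>))"


section \<open>The algebras\<close>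

text \<open>
  The basis vector \<open>e\<^sub>i\<close> is \<open>axis i 1\<close>. The index types \<open>3\<close> and \<open>4\<close> are residues, so that
  \<open>1, \<dots>, 4\<close> are the four distinct elements of the latter (with \<open>4 = 0\<close>).
\<close>

definition table :: "(('n \<times> 'n) \<times> (complex ^ 'n)) list \<Rightarrow> 'n \<Rightarrow> 'n \<Rightarrow> complex ^ 'n::finite"
  where "table T i j = (case map_of T (i, j) of None \<Rightarrow> 0 | Some v \<Rightarrow> v)"

definition diamond :: "(complex, 4) bracket"
  where "diamond = bracket_of (table
    [((1, 2), axis 3 1), ((2, 1), - axis 3 1),
     ((1, 3), - axis 2 1), ((3, 1), axis 2 1),
     ((2, 3), axis 4 1), ((3, 2), - axis 4 1)])"

definition L2 :: "(complex, 4) bracket"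
  where "L2 = bracket_of (table
    [((1, 2), axis 3 1), ((2, 1), - axis 3 1),
     ((1, 4), axis 1 1), ((4, 1), - axis 1 1),
     ((4, 2), axis 2 1), ((2, 4), - axis 2 1),
     ((4, 4), axis 3 1)])"

definition sl2 :: "(complex, 3) bracket"
  where "sl2 = bracket_of (table
    [((1, 2), axis 3 1), ((2, 1), - axis 3 1),
     ((2, 3), 2 *s axis 2 1), ((3, 2), - 2 *s axis 2 1),
     ((1, 3), - 2 *s axis 1 1), ((3, 1), 2 *s axis 1 1)])"

definition abelian :: "(complex, 'n::finite) bracket"
  where "abelian x y = 0"

definition direct_sum ::
    "(complex, 'm::finite) bracket \<Rightarrow> (complex, 'n::finite) bracket \<Rightarrow> (complex, 'm + 'n) bracket"
    (infixr \<open>\<oplus>\<^sub>L\<close> 65)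
  where "(\<mu> \<oplus>\<^sub>L \<nu>) x y = (\<chi> s. case s of
      Inl i \<Rightarrow> \<mu> (\<chi> i. x $ Inl i) (\<chi> i. y $ Inl i) $ i
    | Inr j \<Rightarrow> \<nu> (\<chi> j. x $ Inr j) (\<chi> j. y $ Inr j) $ j)"

end

(*
  Three perturbations of the bracket of the sum of the diamond algebra and C e5 do the job.
  Adding t e1 to [e2, e3] makes e2, e3 and e4 + t e1 span a copy of sl(2), with centre
  spanned by e4 and e5. Setting [e1, e1] = t e4 gives L2 + C after diagonalising ad e1, whose
  eigenvectors are e2 - i e3 and e2 + i e3. Setting [e5, e5] = t e5 keeps the standard
  invariant form exactly invariant and satisfies the Leibniz identity modulo t^2. It is not a
  coboundary, since coboundaries vanish at the central pair (e5, e5), and it is obstructed in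
  order 2 at (e5, e5, e5), whether or not a form is asked for.
*)
theory Submission
  imports Defs
begin

unbundle no fps_syntax

section \<open>Bilinear brackets in coordinates and on direct sums\<close>

lemma sum_UNIV_Plus:
  "(\<Sum>s\<in>UNIV. f s) = (\<Sum>i\<in>UNIV. f (Inl i)) + (\<Sum>j\<in>UNIV. f (Inr j))"
  for f :: "'a::finite + 'b::finite \<Rightarrow> 'c::comm_monoid_add"
  by (simp flip: UNIV_Plus_UNIV add: sum.Plus)

lemma vec_eq_iff_Plus:
  "x = y \<longleftrightarrow> (\<forall>i. x $ Inl i = y $ Inl i) \<and> (\<forall>j. x $ Inr j = y $ Inr j)"
  for x y :: "'a ^ ('m::finite + 'n::finite)"
  by (simp add: vec_eq_iff split_sum_all)

text \<open>Power series form a ring but not a field, so bilinearity is handled over modules; this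
  lets the same facts serve both coefficient rings.\<close>

lemma module_vec: "module ((*s) :: 'a::comm_ring_1 \<Rightarrow> _ \<Rightarrow> 'a ^ 'n)"
  by unfold_locales (simp_all add: vec_eq_iff algebra_simps)

lemma module_ring: "module ((*) :: 'a::comm_ring_1 \<Rightarrow> _)"
  by unfold_locales (simp_all add: algebra_simps)

lemmas bilinear_over_iff = bilinear_over_def module_hom_iff

lemma bilinear_bracket_of: "bilinear_bracket (bracket_of c)"
  unfolding bilinear_over_iff bracket_of_def
  by (simp add: module_vec vec_eq_iff algebra_simps sum.distrib sum_distrib_left)

lemma bracket_of_nth: "bracket_of c x y $ k = (\<Sum>i\<in>UNIV. \<Sum>j\<in>UNIV. x $ i * y $ j * c i j $ k)"
  by (simp add: bracket_of_def)

lemma bilinear_direct_sum: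
  assumes "bilinear_bracket \<mu>" "bilinear_bracket \<nu>"
  shows "bilinear_bracket (\<mu> \<oplus>\<^sub>L \<nu>)"
proof -
  \<comment> \<open>With \<open>h\<close> equal to \<open>Inl\<close> or \<open>Inr\<close>, these
    say that the projections onto the two summands are linear.\<close>
  have add: "(\<chi> i. x $ h i + y $ h i) = (\<chi> i. x $ h i) + (\<chi> i. y $ h i)"
    and scale: "(\<chi> i. c * x $ h i) = c *s (\<chi> i. x $ h i)"
    for x y :: "complex ^ 'i::finite" and h :: "'j::finite \<Rightarrow> 'i" and c
    by (simp_all add: vec_eq_iff)
  show ?thesis
    using assms unfolding bilinear_over_iff
    by (simp add: module_vec direct_sum_def vec_eq_iff_Plus add scale)
qed

lemma bilinear_abelian: "bilinear_bracket abelian"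
  by (simp add: bilinear_over_iff module_vec abelian_def)

section \<open>Deformations linear in t\<close>

lemma first_order_simps [simp]:
  "first_order \<mu> \<psi> 0 = \<mu>" "first_order \<mu> \<psi> (Suc 0) = \<psi>"
  by (simp_all add: first_order_def)

text \<open>Splitting each structure constant into its two coefficients turns the later checks into
  polynomial identities with \<open>fps_X\<close> as one more variable.\<close>

lemma power_series_bracket_first_order_nth:
  "power_series_bracket (first_order \<mu> \<psi>) x y $ k =
    (\<Sum>i\<in>UNIV. \<Sum>j\<in>UNIV. x $ i * y $ j *
      (fps_const (\<mu> (axis i 1) (axis j 1) $ k) + fps_X * fps_const (\<psi> (axis i 1) (axis j 1) $ k)))"
proof -
  have "Abs_fps (\<lambda>m. first_order \<mu> \<psi> m u v $ k) = fps_const (\<mu> u v $ k) + fps_X * fps_const (\<psi> u v $ k)"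
    for u v
    by (rule fps_ext) (auto simp: first_order_def)
  then show ?thesis
    by (simp add: power_series_bracket_def bracket_of_def)
qed

lemma algebra_isomorphicI:
  assumes "Vector_Spaces.linear (*s) (*s) f"
    and "\<And>x. g (f x) = x" and "\<And>y. f (g y) = y"
    and "\<And>x y. f (\<mu> x y) = \<nu> (f x) (f y)"
  shows "algebra_isomorphic \<mu> \<nu>"
  unfolding algebra_isomorphic_def
  using assms by (intro exI[of _ f] conjI o_bij[of g]) (auto simp: fun_eq_iff)

lemma deformation_first_orderI:
  assumes "bilinear_bracket \<mu>" "bilinear_bracket \<psi>"
    and "\<And>x y z. left_leibnizator (power_series_bracket (first_order \<mu> \<psi>)) x y z = 0"
  shows "deformation \<mu> (first_order \<mu> \<psi>)"
proof -
  have "bilinear_bracket (first_order \<mu> \<psi> m)" for m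
    using assms by (simp add: first_order_def bilinear_over_iff module_vec)
  then show ?thesis
    using assms(3) bilinear_bracket_of
    by (auto simp: deformation_def leibniz_algebra_def power_series_bracket_def)
qed

lemma has_deformation_to_first_orderI:
  assumes "bilinear_bracket \<mu>" "bilinear_bracket \<psi>"
    and "\<And>x y z. left_leibnizator (power_series_bracket (first_order \<mu> \<psi>)) x y z = 0"
    and "\<And>t. t \<noteq> 0 \<Longrightarrow> algebra_isomorphic (\<lambda>x y. \<mu> x y + t *s \<psi> x y) \<nu>"
  shows "has_deformation_to \<mu> \<nu>"
proof -
  have "\<forall>\<^sub>F t in at 0. algebra_isomorphic (\<lambda>x y. \<Sum>m\<le>1. t ^ m *s first_order \<mu> \<psi> m x y) \<nu>"
    using assms(4) by (auto simp: eventually_at intro: exI[of _ 1])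
  moreover have "\<forall>m>1. first_order \<mu> \<psi> m = (\<lambda>x y. 0)"
    by (simp add: first_order_def fun_eq_iff)
  ultimately show ?thesis
    using deformation_first_orderI[OF assms(1-3)] unfolding has_deformation_to_def by blast
qed

section \<open>The obstruction in order 2\<close>

lemma sum_axis: "(\<Sum>j\<in>UNIV. axis i 1 $ j * g j) = g i"
  for g :: "'n::finite \<Rightarrow> 'a::comm_ring_1"
  by (simp add: axis_def if_distrib if_distribR cong: if_cong)

text \<open>
  At \<open>(e\<^sub>i, e\<^sub>i, e\<^sub>i)\<close> the terms of order \<open>t\<^sup>2\<close> in which \<open>\<phi> 2\<close> occurs also contain \<open>\<mu>\<close> with
  an argument \<open>e\<^sub>i\<close>, so no choice of \<open>\<phi> 2\<close> can cancel those of \<open>\<phi> 1 \<circ> \<phi> 1\<close>.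
\<close>
lemma not_deformation_if_idempotent:
  assumes ann: "\<And>y. \<mu> (axis i 1) y = 0" "\<And>y. \<mu> y (axis i 1) = 0"
    and psi: "\<phi> 1 (axis i 1) (axis i 1) = axis i 1"
  shows "\<not> deformation \<mu> \<phi>"
proof
  assume def: "deformation \<mu> \<phi>"
  let ?P = "power_series_bracket \<phi>" and ?e = "axis i 1 :: complex fps ^ 'a"
  let ?c = "\<lambda>j k l. Abs_fps (\<lambda>m. \<phi> m (axis j 1) (axis k 1) $ l)"
  have [simp]: "\<phi> 0 = \<mu>"
    using def by (simp add: deformation_def)
  have L: "?P ?e y $ k = (\<Sum>j\<in>UNIV. y $ j * ?c i j k)"
    and R: "?P y ?e $ k = (\<Sum>j\<in>UNIV. y $ j * ?c j i k)" for y k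
    by (simp_all add: power_series_bracket_def bracket_of_nth mult.assoc sum_axis
        flip: sum_distrib_left)
  have ee: "?P ?e ?e $ k = ?c i i k" for k
    by (simp add: L sum_axis)
  \<comment> \<open>Since \<open>\<mu>\<close> annihilates \<open>axis i 1\<close>, both factors in
    the products below have zero constant term wherever this is applied.\<close>
  have two: "fps_nth (a * b) 2 = fps_nth a 1 * fps_nth b 1"
    if "fps_nth a 0 = 0" "fps_nth b 0 = 0" for a b :: "complex fps"
    using that by (simp add: fps_mult_nth numeral_2_eq_2)
  \<comment> \<open>The t^2 coefficient reduces to a coordinate of \<open>\<phi> 1\<close> applied
    twice, and \<open>\<phi> 1\<close> fixes the idempotent.\<close>
  have "fps_nth (?P ?e (?P ?e ?e) $ i) 2 = 1" "fps_nth (?P (?P ?e ?e) ?e $ i) 2 = 1"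
    by (simp_all add: L R ee ann fps_sum_nth two psi sum_axis del: One_nat_def)
  \<comment> \<open>All three iterated products coincide here: 1 - (1 + 1) = -1 on the left, 1 - (1
    - 1) = 1 on the right.\<close>
  then have "fps_nth (left_leibnizator ?P ?e ?e ?e $ i) 2 = -1"
    "fps_nth (right_leibnizator ?P ?e ?e ?e $ i) 2 = 1"
    by (simp_all add: left_leibnizator_def right_leibnizator_def)
  moreover have "left_leibnizator ?P ?e ?e ?e = 0 \<or> right_leibnizator ?P ?e ?e ?e = 0"
    using def by (auto simp: deformation_def leibniz_algebra_def)
  ultimately show False
    by auto
qed

section \<open>The diamond algebra plus C e5 and its three perturbations\<close>

abbreviation d5 :: "(complex, 4 + 1) bracket"
  where "d5 \<equiv> diamond \<oplus>\<^sub>L abelian"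

lemma d5_nth:
  "d5 x y $ Inl 1 = 0"
  "d5 x y $ Inl 2 = x $ Inl 3 * y $ Inl 1 - x $ Inl 1 * y $ Inl 3"
  "d5 x y $ Inl 3 = x $ Inl 1 * y $ Inl 2 - x $ Inl 2 * y $ Inl 1"
  "d5 x y $ Inl 4 = x $ Inl 2 * y $ Inl 3 - x $ Inl 3 * y $ Inl 2"
  "d5 x y $ Inr j = 0"
  by (simp_all add: direct_sum_def diamond_def abelian_def bracket_of_nth sum_4 table_def axis_def)

lemma bilinear_d5: "bilinear_bracket d5"
  by (simp add: bilinear_direct_sum bilinear_abelian diamond_def bilinear_bracket_of)

definition psi_sl2 :: "(complex, 4 + 1) bracket"
  where "psi_sl2 x y = axis (Inl 1) (x $ Inl 2 * y $ Inl 3 - x $ Inl 3 * y $ Inl 2)"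

definition psi_L2 :: "(complex, 4 + 1) bracket"
  where "psi_L2 x y = axis (Inl 4) (x $ Inl 1 * y $ Inl 1)"

definition psi_idem :: "(complex, 4 + 1) bracket"
  where "psi_idem x y = axis (Inr 1) (x $ Inr 1 * y $ Inr 1)"

lemmas psi_defs = psi_sl2_def psi_L2_def psi_idem_def

lemma bilinear_psi:
  "bilinear_bracket psi_sl2" "bilinear_bracket psi_L2" "bilinear_bracket psi_idem"
  by (simp_all add: bilinear_over_iff module_vec psi_defs vec_eq_iff axis_def algebra_simps)

lemma psi_sl2_series_nth:
  "power_series_bracket (first_order d5 psi_sl2) x y $ Inl 1 =
    fps_X * (x $ Inl 2 * y $ Inl 3 - x $ Inl 3 * y $ Inl 2)"
  "power_series_bracket (first_order d5 psi_sl2) x y $ Inl 2 =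
    x $ Inl 3 * y $ Inl 1 - x $ Inl 1 * y $ Inl 3"
  "power_series_bracket (first_order d5 psi_sl2) x y $ Inl 3 =
    x $ Inl 1 * y $ Inl 2 - x $ Inl 2 * y $ Inl 1"
  "power_series_bracket (first_order d5 psi_sl2) x y $ Inl 4 =
    x $ Inl 2 * y $ Inl 3 - x $ Inl 3 * y $ Inl 2"
  "power_series_bracket (first_order d5 psi_sl2) x y $ Inr j = 0"
  by (simp_all add: power_series_bracket_first_order_nth sum_UNIV_Plus sum_4 d5_nth psi_defs
      axis_def algebra_simps flip: fps_const_neg)

lemma psi_L2_series_nth:
  "power_series_bracket (first_order d5 psi_L2) x y $ Inl 1 = 0"
  "power_series_bracket (first_order d5 psi_L2) x y $ Inl 2 =
    x $ Inl 3 * y $ Inl 1 - x $ Inl 1 * y $ Inl 3"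
  "power_series_bracket (first_order d5 psi_L2) x y $ Inl 3 =
    x $ Inl 1 * y $ Inl 2 - x $ Inl 2 * y $ Inl 1"
  "power_series_bracket (first_order d5 psi_L2) x y $ Inl 4 =
    x $ Inl 2 * y $ Inl 3 - x $ Inl 3 * y $ Inl 2 + fps_X * (x $ Inl 1 * y $ Inl 1)"
  "power_series_bracket (first_order d5 psi_L2) x y $ Inr j = 0"
  by (simp_all add: power_series_bracket_first_order_nth sum_UNIV_Plus sum_4 d5_nth psi_defs
      axis_def algebra_simps flip: fps_const_neg)

lemma psi_idem_series_nth:
  "power_series_bracket (first_order d5 psi_idem) x y $ Inl 1 = 0"
  "power_series_bracket (first_order d5 psi_idem) x y $ Inl 2 =
    x $ Inl 3 * y $ Inl 1 - x $ Inl 1 * y $ Inl 3"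
  "power_series_bracket (first_order d5 psi_idem) x y $ Inl 3 =
    x $ Inl 1 * y $ Inl 2 - x $ Inl 2 * y $ Inl 1"
  "power_series_bracket (first_order d5 psi_idem) x y $ Inl 4 =
    x $ Inl 2 * y $ Inl 3 - x $ Inl 3 * y $ Inl 2"
  "power_series_bracket (first_order d5 psi_idem) x y $ Inr j = fps_X * (x $ Inr 1 * y $ Inr 1)"
  by (simp_all add: power_series_bracket_first_order_nth sum_UNIV_Plus sum_4 d5_nth psi_defs
      axis_def algebra_simps flip: fps_const_neg)

text \<open>The bracket is skew with e4 and e5 central, so only the Jacobi identity at e1, e2, e3
  matters; there every double bracket is a multiple of some [ei, ei] = 0.\<close>

lemma leibniz_psi_sl2: "left_leibnizator (power_series_bracket (first_order d5 psi_sl2)) x y z = 0"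
  by (simp add: left_leibnizator_def vec_eq_iff_Plus forall_4 psi_sl2_series_nth algebra_simps)

text \<open>The added term lies in the span of the central e4, and no product has an e1 component,
  so it drops out of all iterated products and the Jacobi identity of \<open>d5\<close>
  remains.\<close>

lemma leibniz_psi_L2: "left_leibnizator (power_series_bracket (first_order d5 psi_L2)) x y z = 0"
  by (simp add: left_leibnizator_def vec_eq_iff_Plus forall_4 psi_L2_series_nth algebra_simps)

section \<open>The two deformations\<close>

lemma has_deformation_to_sl2: "has_deformation_to d5 (sl2 \<oplus>\<^sub>L (abelian :: (complex, 2) bracket))"
proof (rule has_deformation_to_first_orderI[OF bilinear_d5 bilinear_psi(1) leibniz_psi_sl2])
  fix t :: complex assume t: "t \<noteq> 0"
  let ?f = "\<lambda>x :: complex ^ (4 + 1).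
    (\<chi> s. case s of
        Inl i \<Rightarrow> vector [- (t / 2) * (x $ Inl 2 + \<i> * x $ Inl 3),
          (x $ Inl 2 - \<i> * x $ Inl 3) / 2, \<i> / 2 * x $ Inl 1] $ i
      | Inr j \<Rightarrow> vector [x $ Inl 4 - x $ Inl 1 / t, x $ Inr 1] $ j) :: complex ^ (3 + 2)"
  \<comment> \<open>The inverse sends the sl(2) basis to -(e2 - i e3)/t, e2 + i e3 and -(2i/t)(e4 +
    t e1), and the abelian part to e4, e5. The first two are eigenvectors of ad e1; the scalars give
    the third eigenvalues 2 and -2 on them and make it their bracket.\<close>
  let ?g = "\<lambda>u :: complex ^ (3 + 2).
    (\<chi> s. case s of
        Inl i \<Rightarrow> if i = 1 then - 2 * \<i> * u $ Inl 3
          else if i = 2 then u $ Inl 2 - u $ Inl 1 / t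
          else if i = 3 then \<i> * (u $ Inl 1 / t + u $ Inl 2)
          else u $ Inr 1 - 2 * \<i> * u $ Inl 3 / t
      | Inr j \<Rightarrow> u $ Inr 2) :: complex ^ (4 + 1)"
  have sl2: "(sl2 \<oplus>\<^sub>L \<nu>) u v $ Inl 1 = 2 * (u $ Inl 3 * v $ Inl 1 - u $ Inl 1 * v $ Inl 3)"
    "(sl2 \<oplus>\<^sub>L \<nu>) u v $ Inl 2 = 2 * (u $ Inl 2 * v $ Inl 3 - u $ Inl 3 * v $ Inl 2)"
    "(sl2 \<oplus>\<^sub>L \<nu>) u v $ Inl 3 = u $ Inl 1 * v $ Inl 2 - u $ Inl 2 * v $ Inl 1"
    "(sl2 \<oplus>\<^sub>L abelian) u v $ Inr j = 0"
    for u v :: "complex ^ (3 + 2)" and \<nu> j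
    by (simp_all add: direct_sum_def abelian_def sl2_def bracket_of_nth sum_3 table_def axis_def
        algebra_simps)
  show "algebra_isomorphic (\<lambda>x y. d5 x y + t *s psi_sl2 x y) (sl2 \<oplus>\<^sub>L (abelian :: (complex, 2) bracket))"
  proof (rule algebra_isomorphicI[of ?f ?g])
    show "Vector_Spaces.linear (*s) (*s) ?f"
      using t by (simp add: Vector_Spaces.linear_iff vec.vector_space_axioms vec_eq_iff_Plus forall_2 forall_3 field_simps)
    show "?g (?f x) = x" for x
      using t by (simp add: vec_eq_iff_Plus forall_4 field_simps)
    show "?f (?g u) = u" for u
      using t by (simp add: vec_eq_iff_Plus forall_2 forall_3 field_simps)
    show "?f (d5 x y + t *s psi_sl2 x y) = (sl2 \<oplus>\<^sub>L abelian) (?f x) (?f y)" for x y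
      using t by (simp add: vec_eq_iff_Plus forall_2 forall_3 d5_nth psi_sl2_def axis_def
          sl2 field_simps)
  qed
qed

lemma has_deformation_to_L2: "has_deformation_to d5 (L2 \<oplus>\<^sub>L (abelian :: (complex, 1) bracket))"
proof (rule has_deformation_to_first_orderI[OF bilinear_d5 bilinear_psi(2) leibniz_psi_L2])
  fix t :: complex assume t: "t \<noteq> 0"
  let ?f = "\<lambda>x :: complex ^ (4 + 1).
    (\<chi> s. case s of
        Inl i \<Rightarrow> if i = 1 then (x $ Inl 3 - \<i> * x $ Inl 2) / t
          else if i = 2 then (x $ Inl 2 - \<i> * x $ Inl 3) / 2
          else if i = 3 then - x $ Inl 4 / t
          else - \<i> * x $ Inl 1
      | Inr j \<Rightarrow> x $ Inr j) :: complex ^ (4 + 1)"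
  \<comment> \<open>The basis of L2 goes to (t i/2)(e2 - i e3), e2 + i e3, -t e4 and i e1. The
    factor i makes the eigenvalues of ad(i e1) equal to -1 and 1; then [i e1, i e1] = -t e4 fixes
    the third vector and the bracket of the first two fixes their scale.\<close>
  let ?g = "\<lambda>u :: complex ^ (4 + 1).
    (\<chi> s. case s of
        Inl i \<Rightarrow> if i = 1 then \<i> * u $ Inl 4
          else if i = 2 then t * \<i> / 2 * u $ Inl 1 + u $ Inl 2
          else if i = 3 then t / 2 * u $ Inl 1 + \<i> * u $ Inl 2
          else - t * u $ Inl 3
      | Inr j \<Rightarrow> u $ Inr j) :: complex ^ (4 + 1)"
  have L2: "(L2 \<oplus>\<^sub>L \<nu>) u v $ Inl 1 = u $ Inl 1 * v $ Inl 4 - u $ Inl 4 * v $ Inl 1"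
    "(L2 \<oplus>\<^sub>L \<nu>) u v $ Inl 2 = u $ Inl 4 * v $ Inl 2 - u $ Inl 2 * v $ Inl 4"
    "(L2 \<oplus>\<^sub>L \<nu>) u v $ Inl 3 =
      u $ Inl 1 * v $ Inl 2 - u $ Inl 2 * v $ Inl 1 + u $ Inl 4 * v $ Inl 4"
    "(L2 \<oplus>\<^sub>L \<nu>) u v $ Inl 4 = 0"
    "(L2 \<oplus>\<^sub>L abelian) u v $ Inr j = 0"
    for u v :: "complex ^ (4 + 1)" and \<nu> j
    by (simp_all add: direct_sum_def abelian_def L2_def bracket_of_nth sum_4 table_def axis_def
        algebra_simps)
  show "algebra_isomorphic (\<lambda>x y. d5 x y + t *s psi_L2 x y) (L2 \<oplus>\<^sub>L (abelian :: (complex, 1) bracket))"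
  proof (rule algebra_isomorphicI[of ?f ?g])
    show "Vector_Spaces.linear (*s) (*s) ?f"
      using t by (simp add: Vector_Spaces.linear_iff vec.vector_space_axioms vec_eq_iff_Plus forall_4 field_simps)
    show "?g (?f x) = x" for x
      using t by (simp add: vec_eq_iff_Plus forall_4 field_simps)
    show "?f (?g u) = u" for u
      using t by (simp add: vec_eq_iff_Plus forall_4 field_simps)
    show "?f (d5 x y + t *s psi_L2 x y) = (L2 \<oplus>\<^sub>L abelian) (?f x) (?f y)" for x y
      using t by (simp add: vec_eq_iff_Plus forall_4 d5_nth psi_L2_def axis_def
          L2 field_simps)
  qed
qed

section \<open>The obstructed metric infinitesimal deformation\<close>

lemma metric_infinitesimal_psi_idem: "metric_infinitesimal_deformation d5 psi_idem"
proof -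
  let ?P = "power_series_bracket (first_order d5 psi_idem)"
  \<comment> \<open>e1 is paired with e4, while e2, e3, e5 are orthonormal. Invariance survives the
    perturbation because it adds t x5 y5 z5 to both sides.\<close>
  let ?B = "\<lambda>x y :: complex fps ^ (4 + 1). x $ Inl 1 * y $ Inl 4 + x $ Inl 4 * y $ Inl 1
    + x $ Inl 2 * y $ Inl 2 + x $ Inl 3 * y $ Inl 3 + x $ Inr 1 * y $ Inr 1"
  \<comment> \<open>On C e5 the product is commutative and associative, so x(yz) - (xy)z - y(xz)
    leaves one negative triple product, carrying t^2.\<close>
  have "left_leibnizator ?P x y z = axis (Inr 1) (- (fps_X ^ 2 * (x $ Inr 1 * y $ Inr 1 * z $ Inr 1)))" for x y z
    by (simp add: left_leibnizator_def vec_eq_iff_Plus forall_4 psi_idem_series_nth axis_def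
        power2_eq_square algebra_simps)
  then have "zero_mod_t2 (left_leibnizator ?P x y z)" for x y z
    by (simp add: zero_mod_t2_def axis_def)
  then have "infinitesimal_deformation d5 psi_idem"
    by (simp add: infinitesimal_deformation_def bilinear_d5 bilinear_psi)
  moreover have "bilinear_form ?B"
    by (simp add: bilinear_over_iff module_vec module_ring algebra_simps)
  moreover have "symmetric_form ?B"
    by (simp add: symmetric_form_def algebra_simps)
  moreover have "\<forall>k. fps_nth (x $ k) 0 = 0" if "\<forall>y. fps_nth (?B x y) 0 = 0"
    for x :: "complex fps ^ (4 + 1)"
    \<comment> \<open>Pairing with each basis vector reads off one coordinate of
      \<open>x\<close>.\<close>
    using that[rule_format, of "axis (Inl 1) 1"] that[rule_format, of "axis (Inl 2) 1"]
      that[rule_format, of "axis (Inl 3) 1"] that[rule_format, of "axis (Inl 4) 1"]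
      that[rule_format, of "axis (Inr 1) 1"]
    by (simp add: split_sum_all forall_4 axis_def)
  moreover have "invariant_form ?P ?B"
    by (simp add: invariant_form_def psi_idem_series_nth algebra_simps)
  ultimately show ?thesis
    unfolding metric_infinitesimal_deformation_def by blast
qed

lemma d5_annihilator: "d5 (axis (Inr 1) 1) y = 0" "d5 y (axis (Inr 1) 1) = 0"
  by (simp_all add: vec_eq_iff_Plus forall_4 d5_nth axis_def)

lemma psi_idem_axis: "psi_idem (axis (Inr 1) 1) (axis (Inr 1) 1) = axis (Inr 1) 1"
  by (simp add: psi_idem_def axis_def)

lemma not_coboundary_psi_idem: "\<not> leibniz_coboundary d5 psi_idem"
proof
  assume "leibniz_coboundary d5 psi_idem"
  then obtain f where f: "Vector_Spaces.linear (*s) (*s) f"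
    and "psi_idem x y = d5 x (f y) + d5 (f x) y - f (d5 x y)" for x y
    unfolding leibniz_coboundary_def by blast
  from this(2)[of "axis (Inr 1) 1" "axis (Inr 1) 1"] show False
    using vec.linear_0[OF f] by (simp add: d5_annihilator psi_idem_axis)
qed

theorem theorem5p2:
  shows "has_deformation_to (diamond \<oplus>\<^sub>L (abelian :: (complex, 1) bracket))
           (sl2 \<oplus>\<^sub>L (abelian :: (complex, 2) bracket))
    \<and> has_deformation_to (diamond \<oplus>\<^sub>L (abelian :: (complex, 1) bracket))
           (L2 \<oplus>\<^sub>L (abelian :: (complex, 1) bracket))
    \<and> (\<exists>\<psi>. metric_infinitesimal_deformation (diamond \<oplus>\<^sub>L (abelian :: (complex, 1) bracket)) \<psi>
          \<and> \<not> leibniz_coboundary (diamond \<oplus>\<^sub>L (abelian :: (complex, 1) bracket)) \<psi>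
          \<and> \<not> (\<exists>\<phi>. real_metric_deformation (diamond \<oplus>\<^sub>L (abelian :: (complex, 1) bracket)) \<phi>
                  \<and> \<phi> 1 = \<psi>))"
proof -
  \<comment> \<open>Any extension would in particular be a deformation, which the idempotent e5
    rules out.\<close>
  have "\<not> real_metric_deformation d5 \<phi>" if "\<phi> 1 = psi_idem" for \<phi>
    using not_deformation_if_idempotent[of d5 "Inr 1" \<phi>, OF d5_annihilator] that psi_idem_axis
    by (auto simp: real_metric_deformation_def)
  then show ?thesis
    using has_deformation_to_sl2 has_deformation_to_L2 metric_infinitesimal_psi_idem
      not_coboundary_psi_idem by blast
qed

end
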